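(* Every weak dimension function on a structure $\mathcal M$ is a dimension function on $\mathcal M$.
   Context: "Definable" means definable in the structure with parameters; $\mathbb N$ is the set of nonnegative integers. Let $\mathcal M=(M,\ldots)$ be a structure, $\mathrm{Def}_n(\mathcal M)$ the collection of definable subsets of $M^n$, and $\mathrm{Def}(\mathcal M)=\bigcup_{n>0}\mathrm{Def}_n(\mathcal M)$. Let $\Pi:M^n\to M^{n-1}$ be the projection forgetting the last coordinate, and for $X\subseteq M^n$, $x\in\Pi(X)$, put $X_x^{\Pi}=\{y\in M: (x,y)\in X\}$. Convention: $-\infty+i=-\infty$. A *dimension function* on $\mathcal M$ is a function $\dim:\mathrm{Def}(\mathcal M)\to\mathbb N\cup\{-\infty\}$ such that for every $n>0$: (1) $\dim(\emptyset)=-\infty$, $\dim(\{a\})=0$ for each $a\in M$, and $\dim(M)=1$; $(2)_n$ $\dim(X\cup Y)=\max\{\dim X,\dim Y\}$ for $X,Y\in\mathrm{Def}_n(\mathcal M)$; $(3)_n$ $\dim X=\dim X^{\sigma}$ for each $X\in\mathrm{Def}_n(\mathcal M)$ and each permutation $\sigma$ of $\{1,\dots,n\}$, where $X^\sigma=\{(x_{\sigma(1)},\dots,x_{\sigma(n)}):(x_1,\dots,x_n)\in X\}$; $(4)_n$ if $n>1$ and $X\in\mathrm{Def}_n(\mathcal M)$, then for $i=0,1$ the set $X(i)=\{x\in\Pi(X):\dim X_x^{\Pi}=i\}$ belongs to $\mathrm{Def}_{n-1}(\mathcal M)$ and $\dim(X\cap\Pi^{-1}(X(i)))=\dim(X(i))+i$.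 A *weak dimension function* on $\mathcal M$ is a function $\dim:\mathrm{Def}(\mathcal M)\to\mathbb N\cup\{-\infty\}$ satisfying (1), $(2)_1$ (i.e. $(2)_n$ for $n=1$ only), and the following: $(3')$ $\dim X=\dim X^{\mathrm{switch}}$ for each $X\in\mathrm{Def}_2(\mathcal M)$, where $X^{\mathrm{switch}}=\{(x_1,x_2)\in M^2:(x_2,x_1)\in X\}$; $(4')_n$ for every $n>1$ and $X\in\mathrm{Def}_n(\mathcal M)$, with $X(i)=\{x\in\Pi(X):\dim X_x^{\Pi}=i\}$ for $i=0,1$, one has $X(i)\in\mathrm{Def}_{n-1}(\mathcal M)$ and $\dim X=\max\{\dim(X(i))+i: i=0,1\}$. *)

theory Defs
  imports Main "HOL-Library.Option_ord" "HOL-Combinatorics.Permutations"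
begin

section \<open>First-order structures and definable sets\<close>

text \<open>
  The universe of a structure is the type \<^typ>\<open>'a\<close>. A language is given by two sets of
  symbols paired with their arities, so it may have no function or no relation symbols at all;
  constants are function symbols of arity 0. The interpretations only matter at the
  listed symbols and at argument lists of the listed length.
\<close>

record ('f, 'r, 'a) fo_structure =
  funs :: "('f \<times> nat) set"
  rels :: "('r \<times> nat) set"
  fun_interp :: "'f \<Rightarrow> 'a list \<Rightarrow> 'a"
  rel_interp :: "'r \<Rightarrow> 'a list \<Rightarrow> bool"

datatype 'f fo_term = Var nat | Fun 'f "'f fo_term list"

datatype ('f, 'r) fo_formula =
    Eq "'f fo_term" "'f fo_term"
  | Rel 'r "'f fo_term list"
  | Neg "('f, 'r) fo_formula"
  | And "('f, 'r) fo_formula" "('f, 'r) fo_formula"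
  | Ex nat "('f, 'r) fo_formula"

fun wf_term :: "('f, 'r, 'a) fo_structure \<Rightarrow> 'f fo_term \<Rightarrow> bool" where
  "wf_term S (Var k) \<longleftrightarrow> True"
| "wf_term S (Fun f ts) \<longleftrightarrow> (f, length ts) \<in> funs S \<and> (\<forall>t\<in>set ts. wf_term S t)"

fun wf_formula :: "('f, 'r, 'a) fo_structure \<Rightarrow> ('f, 'r) fo_formula \<Rightarrow> bool" where
  "wf_formula S (Eq s t) \<longleftrightarrow> wf_term S s \<and> wf_term S t"
| "wf_formula S (Rel r ts) \<longleftrightarrow> (r, length ts) \<in> rels S \<and> (\<forall>t\<in>set ts. wf_term S t)"
| "wf_formula S (Neg \<phi>) \<longleftrightarrow> wf_formula S \<phi>"
| "wf_formula S (And \<phi> \<psi>) \<longleftrightarrow> wf_formula S \<phi> \<and> wf_formula S \<psi>"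
| "wf_formula S (Ex k \<phi>) \<longleftrightarrow> wf_formula S \<phi>"

fun eval_term :: "('f, 'r, 'a) fo_structure \<Rightarrow> (nat \<Rightarrow> 'a) \<Rightarrow> 'f fo_term \<Rightarrow> 'a" where
  "eval_term S e (Var k) = e k"
| "eval_term S e (Fun f ts) = fun_interp S f (map (eval_term S e) ts)"

fun sat :: "('f, 'r, 'a) fo_structure \<Rightarrow> (nat \<Rightarrow> 'a) \<Rightarrow> ('f, 'r) fo_formula \<Rightarrow> bool" where
  "sat S e (Eq s t) \<longleftrightarrow> eval_term S e s = eval_term S e t"
| "sat S e (Rel r ts) \<longleftrightarrow> rel_interp S r (map (eval_term S e) ts)"
| "sat S e (Neg \<phi>) \<longleftrightarrow> \<not> sat S e \<phi>"
| "sat S e (And \<phi> \<psi>) \<longleftrightarrow> sat S e \<phi> \<and> sat S e \<psi>"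
| "sat S e (Ex k \<phi>) \<longleftrightarrow> (\<exists>a. sat S (e(k := a)) \<phi>)"

text \<open>
  \<open>M\<^sup>n\<close> is the set of lists of length \<open>n\<close>. The variables \<open>0, \<dots>, n - 1\<close> stand for
  the coordinates; the remaining free variables of the formula are the parameters, whose values
  are given by \<open>p\<close>.
\<close>

definition Def_n :: "('f, 'r, 'a) fo_structure \<Rightarrow> nat \<Rightarrow> 'a list set set" where
  "Def_n S n = {X. \<exists>\<phi> p. wf_formula S \<phi> \<and>
     X = {xs. length xs = n \<and> sat S (\<lambda>k. if k < n then xs ! k else p k) \<phi>}}"

section \<open>Dimension functions\<close>

text \<open>
  A value in \<open>\<nat> \<union> {-\<infinity>}\<close> is a \<^typ>\<open>nat option\<close>, where \<^term>\<open>None\<close> is \<open>-\<infinity>\<close>;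
  the order of \<^theory>\<open>HOL-Library.Option_ord\<close> puts it below every \<^term>\<open>Some k\<close>.
  A function on \<open>Def(M)\<close> is a total function on sets of lists of which only the values at members
  of \<^term>\<open>Def_n S n\<close> with \<open>n > 0\<close> are used. The empty set lies in every
  \<^term>\<open>Def_n S n\<close> and has a single dimension.
\<close>

definition shift :: "nat option \<Rightarrow> nat \<Rightarrow> nat option" where
  "shift d i = map_option (\<lambda>k. k + i) d"

definition permute_coords :: "nat \<Rightarrow> (nat \<Rightarrow> nat) \<Rightarrow> 'a list set \<Rightarrow> 'a list set" where
  "permute_coords n \<sigma> X = (\<lambda>xs. map (\<lambda>i. xs ! \<sigma> i) [0..<n]) ` X"

definition switch :: "'a list set \<Rightarrow> 'a list set" where
  "switch X = {[x1, x2] | x1 x2. [x2, x1] \<in> X}"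

text \<open>The projection \<open>\<Pi>\<close> forgetting the last coordinate is \<^const>\<open>butlast\<close>.\<close>

definition fiber :: "'a list set \<Rightarrow> 'a list \<Rightarrow> 'a list set" where
  "fiber X x = {[y] | y. x @ [y] \<in> X}"

definition fiber_dim_set :: "('a list set \<Rightarrow> nat option) \<Rightarrow> 'a list set \<Rightarrow> nat \<Rightarrow> 'a list set" where
  "fiber_dim_set dim X i = {x \<in> butlast ` X. dim (fiber X x) = Some i}"

definition dimension_function ::
  "('f, 'r, 'a) fo_structure \<Rightarrow> ('a list set \<Rightarrow> nat option) \<Rightarrow> bool" where
  "dimension_function S dim \<longleftrightarrow>
     dim {} = None \<and> (\<forall>a. dim {[a]} = Some 0) \<and> dim {xs. length xs = 1} = Some 1 \<and>
     (\<forall>n>0. \<forall>X\<in>Def_n S n. \<forall>Y\<in>Def_n S n. dim (X \<union> Y) = max (dim X) (dim Y)) \<and>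
     (\<forall>n>0. \<forall>X\<in>Def_n S n. \<forall>\<sigma>. \<sigma> permutes {..<n} \<longrightarrow> dim X = dim (permute_coords n \<sigma> X)) \<and>
     (\<forall>n>1. \<forall>X\<in>Def_n S n. \<forall>i\<in>{0, 1}.
        fiber_dim_set dim X i \<in> Def_n S (n - 1) \<and>
        dim (X \<inter> butlast -` fiber_dim_set dim X i) = shift (dim (fiber_dim_set dim X i)) i)"

definition weak_dimension_function ::
  "('f, 'r, 'a) fo_structure \<Rightarrow> ('a list set \<Rightarrow> nat option) \<Rightarrow> bool" where
  "weak_dimension_function S dim \<longleftrightarrow>
     dim {} = None \<and> (\<forall>a. dim {[a]} = Some 0) \<and> dim {xs. length xs = 1} = Some 1 \<and>
     (\<forall>X\<in>Def_n S 1. \<forall>Y\<in>Def_n S 1. dim (X \<union> Y) = max (dim X) (dim Y)) \<and>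
     (\<forall>X\<in>Def_n S 2. dim X = dim (switch X)) \<and>
     (\<forall>n>1. \<forall>X\<in>Def_n S n.
        (\<forall>i\<in>{0, 1}. fiber_dim_set dim X i \<in> Def_n S (n - 1)) \<and>
        dim X = Max ((\<lambda>i. shift (dim (fiber_dim_set dim X i)) i) ` {0, 1}))"

end

theory Submission imports Defs begin

text \<open>
  Additivity for unions passes from \<open>n\<close> to \<open>n + 1\<close> because fibers commute with unions. Permutations
  of coordinates are products of permutations fixing the last coordinate, which act on the base of the
  fibration, and of the exchange of the last two coordinates. For the latter, applying the fiber formula
  twice expresses \<open>dim X\<close> through the sets of those \<open>a\<close> for which the section \<open>X\<^sub>a\<close> in the
  last two coordinates has dimension \<open>0\<close>, \<open>1\<close> or \<open>2\<close>, and these do not change when every section is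
  switched.
\<close>

section \<open>Definable sets\<close>

primrec rename_term :: "(nat \<Rightarrow> nat) \<Rightarrow> 'f fo_term \<Rightarrow> 'f fo_term" where
  "rename_term f (Var k) = Var (f k)"
| "rename_term f (Fun g ts) = Fun g (map (rename_term f) ts)"

text \<open>Bound variables are renamed along with the free ones. Capture is excluded by using only
  injective renamings.\<close>

primrec rename_formula :: "(nat \<Rightarrow> nat) \<Rightarrow> ('f, 'r) fo_formula \<Rightarrow> ('f, 'r) fo_formula" where
  "rename_formula f (Eq s t) = Eq (rename_term f s) (rename_term f t)"
| "rename_formula f (Rel r ts) = Rel r (map (rename_term f) ts)"
| "rename_formula f (Neg \<phi>) = Neg (rename_formula f \<phi>)"
| "rename_formula f (And \<phi> \<psi>) = And (rename_formula f \<phi>) (rename_formula f \<psi>)"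
| "rename_formula f (Ex k \<phi>) = Ex (f k) (rename_formula f \<phi>)"

lemma wf_rename_term [simp]: "wf_term S (rename_term f t) = wf_term S t"
  by (induction t) auto

lemma wf_rename_formula [simp]: "wf_formula S (rename_formula f \<phi>) = wf_formula S \<phi>"
  by (induction \<phi>) auto

lemma eval_rename_term [simp]: "eval_term S e (rename_term f t) = eval_term S (e \<circ> f) t"
proof (induction t)
  case (Fun g ts)
  then have "map (eval_term S e \<circ> rename_term f) ts = map (eval_term S (e \<circ> f)) ts"
    unfolding map_eq_conv comp_apply[of "eval_term S e"] by blast
  then show ?case by (simp only: rename_term.simps eval_term.simps map_map)
qed simp

lemma sat_rename_formula:
  assumes "inj f"
  shows "sat S e (rename_formula f \<phi>) = sat S (e \<circ> f) \<phi>"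
proof (induction \<phi> arbitrary: e)
  case (Ex k \<phi>)
  \<comment> \<open>This is where injectivity enters: an update at position \<open>f k\<close> must
    not be seen by any variable other than \<open>k\<close>.\<close>
  have "e(f k := a) \<circ> f = (e \<circ> f)(k := a)" for a
    using assms by (auto simp: fun_eq_iff inj_eq)
  then show ?case
    by (simp only: rename_formula.simps sat.simps Ex.IH)
qed (simp_all add: comp_def [of "eval_term S _"])

lemma Def_n_length: "X \<in> Def_n S n \<Longrightarrow> xs \<in> X \<Longrightarrow> length xs = n"
  by (auto simp: Def_n_def)

text \<open>Common source of cylinders, sections and permuted sets: variable \<open>k\<close> of the
  formula reads position \<open>f k\<close>, so the choice of \<open>f\<close> decides which
  variables become coordinates and which become parameters.\<close>

lemma Def_n_rename:
  assumes "inj f" "wf_formula S \<phi>"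
  shows "{xs. length xs = n \<and> sat S (\<lambda>k. if f k < n then xs ! f k else p k) \<phi>} \<in> Def_n S n"
proof -
  \<comment> \<open>\<open>inv f\<close> recovers the original index of a parameter; off the range
    of \<open>f\<close> its value is arbitrary, but composition with \<open>f\<close> never reads it
    there.\<close>
  have "(\<lambda>j. if j < n then xs ! j else p (inv f j)) \<circ> f
      = (\<lambda>k. if f k < n then xs ! f k else p k)" for xs
    using assms(1) by (auto simp: fun_eq_iff)
  then show ?thesis
    unfolding Def_n_def using assms
    by (intro CollectI exI[of _ "rename_formula f \<phi>"] exI[of _ "\<lambda>j. p (inv f j)"])
      (simp add: sat_rename_formula)
qed

section \<open>Boolean combinations of definable sets\<close>

lemma Def_n_empty: "{} \<in> Def_n S n"
  unfolding Def_n_def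
  by (intro CollectI exI[of _ "Neg (Eq (Var 0) (Var 0))"]) simp

lemma Def_n_compl:
  assumes "X \<in> Def_n S n"
  shows "{xs. length xs = n} - X \<in> Def_n S n"
proof -
  obtain \<phi> p where "wf_formula S \<phi>"
    and "X = {xs. length xs = n \<and> sat S (\<lambda>k. if k < n then xs ! k else p k) \<phi>}"
    using assms unfolding Def_n_def by blast
  then show ?thesis
    unfolding Def_n_def by (intro CollectI exI[of _ "Neg \<phi>"] exI[of _ p]) auto
qed

text \<open>The parameters of the two formulas are moved to interleaved positions.\<close>

lemma Def_n_Int:
  assumes "X \<in> Def_n S n" "Y \<in> Def_n S n"
  shows "X \<inter> Y \<in> Def_n S n"
proof -
  obtain \<phi> p where \<phi>: "wf_formula S \<phi>"
    and X: "X = {xs. length xs = n \<and> sat S (\<lambda>k. if k < n then xs ! k else p k) \<phi>}"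
    using assms(1) unfolding Def_n_def by blast
  obtain \<psi> q where \<psi>: "wf_formula S \<psi>"
    and Y: "Y = {xs. length xs = n \<and> sat S (\<lambda>k. if k < n then xs ! k else q k) \<psi>}"
    using assms(2) unfolding Def_n_def by blast
  define f where "f k = (if k < n then k else n + 2 * (k - n))" for k
  define g where "g k = (if k < n then k else n + 2 * (k - n) + 1)" for k
  define r where "r j = (if even (j - n) then p (n + (j - n) div 2) else q (n + (j - n) div 2))" for j
  have "inj f" "inj g"
    unfolding inj_def f_def g_def by (auto split: if_splits)
  moreover have "(\<lambda>j. if j < n then xs ! j else r j) \<circ> f = (\<lambda>k. if k < n then xs ! k else p k)"
      and "(\<lambda>j. if j < n then xs ! j else r j) \<circ> g = (\<lambda>k. if k < n then xs ! k else q k)" for xs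
    by (auto simp: fun_eq_iff f_def g_def r_def)
  ultimately show ?thesis
    unfolding Def_n_def using \<phi> \<psi>
    by (intro CollectI exI[of _ "And (rename_formula f \<phi>) (rename_formula g \<psi>)"] exI[of _ r])
      (auto simp: sat_rename_formula X Y)
qed

lemma Def_n_Un:
  assumes "X \<in> Def_n S n" "Y \<in> Def_n S n"
  shows "X \<union> Y \<in> Def_n S n"
proof -
  have "X \<union> Y = {xs. length xs = n} - (({xs. length xs = n} - X) \<inter> ({xs. length xs = n} - Y))"
    using assms Def_n_length by blast
  then show ?thesis
    using assms by (simp only: Def_n_compl Def_n_Int)
qed

lemma Def_n_Diff:
  assumes "X \<in> Def_n S n" "Y \<in> Def_n S n"
  shows "X - Y \<in> Def_n S n"
proof -
  have "X - Y = X \<inter> ({xs. length xs = n} - Y)"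
    using assms Def_n_length by blast
  then show ?thesis
    using assms by (simp only: Def_n_compl Def_n_Int)
qed

section \<open>Cylinders, sections and fibers\<close>

lemma Def_n_cylinder:
  assumes "X \<in> Def_n S n"
  shows "{xs. length xs = Suc n \<and> butlast xs \<in> X} \<in> Def_n S (Suc n)"
proof -
  obtain \<phi> p where \<phi>: "wf_formula S \<phi>"
    and X: "X = {xs. length xs = n \<and> sat S (\<lambda>k. if k < n then xs ! k else p k) \<phi>}"
    using assms unfolding Def_n_def by blast
  \<comment> \<open>Position \<open>n\<close> is now the new last coordinate, which the formula must
    ignore, so all parameters move up by one.\<close>
  define f where "f k = (if k < n then k else Suc k)" for k
  have "inj f"
    unfolding inj_def f_def by auto
  moreover have "(\<lambda>k. if f k < Suc n then xs ! f k else p k)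
      = (\<lambda>k. if k < n then butlast xs ! k else p k)" if "length xs = Suc n" for xs
    using that by (auto simp: fun_eq_iff f_def nth_butlast)
  then have "{xs. length xs = Suc n \<and> butlast xs \<in> X}
      = {xs. length xs = Suc n \<and> sat S (\<lambda>k. if f k < Suc n then xs ! f k else p k) \<phi>}"
    by (auto simp: X)
  ultimately show ?thesis
    using Def_n_rename[OF _ \<phi>, of f] by simp
qed

lemma Def_n_section:
  assumes "X \<in> Def_n S (length a + n)"
  shows "{ys. a @ ys \<in> X} \<in> Def_n S n"
proof -
  let ?m = "length a"
  obtain \<phi> p where \<phi>: "wf_formula S \<phi>"
    and X: "X = {xs. length xs = ?m + n \<and> sat S (\<lambda>k. if k < ?m + n then xs ! k else p k) \<phi>}"
    using assms unfolding Def_n_def by blast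
  \<comment> \<open>The variables of the section come to the front; those of \<open>a\<close> move
    behind them and turn into parameters, whose values \<open>q\<close> takes from
    \<open>a\<close>.\<close>
  define f where "f k = (if k < ?m then k + n else if k < ?m + n then k - ?m else k)" for k
  define q where "q k = (if k < ?m then a ! k else p k)" for k
  have "inj f"
    unfolding inj_def f_def by auto
  moreover have "(\<lambda>k. if f k < n then ys ! f k else q k)
      = (\<lambda>k. if k < ?m + n then (a @ ys) ! k else p k)" for ys
    by (auto simp: fun_eq_iff f_def q_def nth_append)
  then have "{ys. a @ ys \<in> X}
      = {ys. length ys = n \<and> sat S (\<lambda>k. if f k < n then ys ! f k else q k) \<phi>}"
    by (auto simp: X)
  ultimately show ?thesis
    using Def_n_rename[OF _ \<phi>, of f] by simp
qed

text \<open>Over a list of length \<open>n\<close> the fiber is a section with one free coordinate;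
  over any other list it is empty.\<close>

lemma Def_n_fiber:
  assumes "X \<in> Def_n S (Suc n)"
  shows "fiber X x \<in> Def_n S 1"
proof (cases "length x = n")
  case True
  then have "fiber X x = {ys. x @ ys \<in> X}"
    using Def_n_length[OF assms] by (fastforce simp: fiber_def length_Suc_conv)
  then show ?thesis
    using Def_n_section[of X S x 1] assms True by simp
next
  case False
  then have "fiber X x = {}"
    using Def_n_length[OF assms] by (fastforce simp: fiber_def)
  then show ?thesis by (simp add: Def_n_empty)
qed

section \<open>Permutations of coordinates\<close>

text \<open>Rearranging along \<open>\<sigma>\<close> and along \<open>inv \<sigma>\<close> are
  mutually inverse on lists of length \<open>n\<close>. This turns the image into a preimage, from
  which a defining formula and the fibers can be read off.\<close>

lemma mem_permute_coords:
  fixes X :: "'a list set"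
  assumes X: "X \<in> Def_n S n" and \<sigma>: "\<sigma> permutes {..<n}"
  shows "xs \<in> permute_coords n \<sigma> X
    \<longleftrightarrow> length xs = n \<and> map (\<lambda>i. xs ! inv \<sigma> i) [0..<n] \<in> X"
proof -
  have *: "\<sigma> i < n" "inv \<sigma> i < n" if "i < n" for i
    using permutes_in_image[OF \<sigma>] permutes_in_image[OF permutes_inv[OF \<sigma>]] that by auto
  have **: "map (\<lambda>i. map (\<lambda>i. ys ! \<sigma> i) [0..<n] ! inv \<sigma> i) [0..<n] = ys"
      "map (\<lambda>i. map (\<lambda>i. ys ! inv \<sigma> i) [0..<n] ! \<sigma> i) [0..<n] = ys"
    if "length ys = n" for ys :: "'a list"
    by (rule nth_equalityI; use that in \<open>simp add: * permutes_inverses[OF \<sigma>]\<close>)+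
  show ?thesis
  proof
    assume "xs \<in> permute_coords n \<sigma> X"
    then obtain zs where "zs \<in> X" "xs = map (\<lambda>i. zs ! \<sigma> i) [0..<n]"
      unfolding permute_coords_def by blast
    then show "length xs = n \<and> map (\<lambda>i. xs ! inv \<sigma> i) [0..<n] \<in> X"
      using **(1)[of zs] Def_n_length[OF X, of zs] by simp
  next
    assume "length xs = n \<and> map (\<lambda>i. xs ! inv \<sigma> i) [0..<n] \<in> X"
    then show "xs \<in> permute_coords n \<sigma> X"
      unfolding permute_coords_def using **(2) by (intro image_eqI) auto
  qed
qed

lemma Def_n_permute:
  assumes "X \<in> Def_n S n" and \<sigma>: "\<sigma> permutes {..<n}"
  shows "permute_coords n \<sigma> X \<in> Def_n S n"
proof -
  obtain \<phi> p where \<phi>: "wf_formula S \<phi>"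
    and X: "X = {xs. length xs = n \<and> sat S (\<lambda>k. if k < n then xs ! k else p k) \<phi>}"
    using assms unfolding Def_n_def by blast
  have "inv \<sigma> k < n \<longleftrightarrow> k < n" for k
    using permutes_in_image[OF permutes_inv[OF \<sigma>]] by simp
  then have "(\<lambda>k. if k < n then map (\<lambda>i. xs ! inv \<sigma> i) [0..<n] ! k else p k)
      = (\<lambda>k. if inv \<sigma> k < n then xs ! inv \<sigma> k else p k)" for xs
    by (auto simp: fun_eq_iff)
  then have "map (\<lambda>i. xs ! inv \<sigma> i) [0..<n] \<in> X
      \<longleftrightarrow> sat S (\<lambda>k. if inv \<sigma> k < n then xs ! inv \<sigma> k else p k) \<phi>" for xs
    by (simp add: X)
  then have "permute_coords n \<sigma> X
      = {xs. length xs = n \<and> sat S (\<lambda>k. if inv \<sigma> k < n then xs ! inv \<sigma> k else p k) \<phi>}"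
    using mem_permute_coords[OF assms] by blast
  then show ?thesis
    using Def_n_rename[OF permutes_inj[OF permutes_inv[OF \<sigma>]] \<phi>] by simp
qed

text \<open>Entry \<open>i\<close> of the result is entry \<open>\<sigma> i\<close> of the
  intermediate list, hence entry \<open>\<tau> (\<sigma> i)\<close> of the original one: the action
  reverses the order of composition.\<close>

lemma permute_coords_comp:
  assumes "\<sigma> permutes {..<n}"
  shows "permute_coords n \<sigma> (permute_coords n \<tau> X) = permute_coords n (\<tau> \<circ> \<sigma>) X"
proof -
  have "\<sigma> i < n" if "i < n" for i
    using permutes_in_image[OF assms] that by auto
  then show ?thesis
    by (auto simp: permute_coords_def image_image intro!: image_cong)
qed

lemma shift_0 [simp]: "shift d 0 = d"
  by (cases d) (auto simp: shift_def)

section \<open>Weak dimension functions\<close>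

context
  fixes S :: "('f, 'r, 'a) fo_structure" and dim :: "'a list set \<Rightarrow> nat option"
  assumes weak: "weak_dimension_function S dim"
begin

section \<open>First consequences of the axioms\<close>

lemma dim_empty: "dim {} = None"
  using weak by (simp add: weak_dimension_function_def)

lemma dim_switch: "X \<in> Def_n S 2 \<Longrightarrow> dim (switch X) = dim X"
  using weak by (simp add: weak_dimension_function_def)

text \<open>A point off the projection has an empty fiber, whose dimension is \<open>None\<close>
  and so never \<open>Some i\<close>.\<close>

lemma mem_fiber_dim_set: "x \<in> fiber_dim_set dim X i \<longleftrightarrow> dim (fiber X x) = Some i"
proof -
  have "x \<in> butlast ` X" if "fiber X x \<noteq> {}"
    using that by (force simp: fiber_def image_iff)
  then show ?thesis
    using dim_empty by (cases "fiber X x = {}") (auto simp: fiber_dim_set_def)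
qed

lemma Def_n_fiber_dim_set:
  assumes "X \<in> Def_n S (Suc n)" "n > 0" "i \<in> {0, 1}"
  shows "fiber_dim_set dim X i \<in> Def_n S n"
proof -
  have "\<forall>n>1. \<forall>X\<in>Def_n S n. \<forall>i\<in>{0, 1}. fiber_dim_set dim X i \<in> Def_n S (n - 1)"
    using weak unfolding weak_dimension_function_def by blast
  from this[rule_format, of "Suc n" X i] assms show ?thesis by simp
qed

lemma dim_eq:
  assumes "X \<in> Def_n S (Suc n)" "n > 0"
  shows "dim X = max (dim (fiber_dim_set dim X 0)) (shift (dim (fiber_dim_set dim X 1)) 1)"
proof -
  have "\<forall>n>1. \<forall>X\<in>Def_n S n.
      dim X = Max ((\<lambda>i. shift (dim (fiber_dim_set dim X i)) i) ` {0, 1})"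
    using weak unfolding weak_dimension_function_def by blast
  from this[rule_format, of "Suc n" X] assms show ?thesis by simp
qed

text \<open>The whole line absorbs \<open>X\<close> and has dimension 1, so additivity bounds
  \<open>dim X\<close>. This leaves finitely many cases whenever fiber dimensions are
  compared.\<close>

lemma dim_le_1:
  assumes "X \<in> Def_n S 1"
  shows "dim X \<in> {None, Some 0, Some 1}"
proof -
  let ?M = "{xs :: 'a list. length xs = 1}"
  have "?M \<in> Def_n S 1"
    using Def_n_compl[OF Def_n_empty, of 1 S] by simp
  moreover have "X \<union> ?M = ?M"
    using Def_n_length[OF assms] by blast
  moreover have "\<forall>X\<in>Def_n S 1. \<forall>Y\<in>Def_n S 1. dim (X \<union> Y) = max (dim X) (dim Y)"
      and "dim ?M = Some 1"
    using weak unfolding weak_dimension_function_def by blast+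
  ultimately have "max (dim X) (Some 1) = Some 1"
    using assms by metis
  then have "dim X \<le> Some 1"
    by (metis max.cobounded1)
  then show ?thesis
    by (cases "dim X") auto
qed

section \<open>Unions, and restriction to fibers of fixed dimension\<close>

lemma dim_Un:
  assumes "X \<in> Def_n S (Suc n)" "Y \<in> Def_n S (Suc n)"
  shows "dim (X \<union> Y) = max (dim X) (dim Y)"
  using assms
proof (induction n arbitrary: X Y)
  case 0
  then show ?case
    using weak unfolding weak_dimension_function_def One_nat_def by blast
next
  case (Suc n)
  let ?D = "fiber_dim_set dim"
  have XY: "X \<union> Y \<in> Def_n S (Suc (Suc n))"
    using Suc.prems by (rule Def_n_Un)
  have def: "?D Z i \<in> Def_n S (Suc n)" if "Z \<in> {X, Y, X \<union> Y}" "i \<in> {0, 1}" for Z i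
    using Def_n_fiber_dim_set[of Z "Suc n" i] Suc.prems XY that by auto
  have fib: "dim (fiber (X \<union> Y) x) = max (dim (fiber X x)) (dim (fiber Y x))" for x
  proof -
    have "fiber (X \<union> Y) x = fiber X x \<union> fiber Y x"
      by (auto simp: fiber_def)
    moreover have "\<forall>X\<in>Def_n S 1. \<forall>Y\<in>Def_n S 1. dim (X \<union> Y) = max (dim X) (dim Y)"
      using weak unfolding weak_dimension_function_def by blast
    ultimately show ?thesis
      using Def_n_fiber Suc.prems by metis
  qed
  have vals: "dim (fiber X x) \<in> {None, Some 0, Some 1}" "dim (fiber Y x) \<in> {None, Some 0, Some 1}" for x
    using dim_le_1 Def_n_fiber Suc.prems by metis+
  have "?D (X \<union> Y) 1 = ?D X 1 \<union> ?D Y 1"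
    unfolding set_eq_iff Un_iff mem_fiber_dim_set fib
  proof
    show "max (dim (fiber X x)) (dim (fiber Y x)) = Some 1
        \<longleftrightarrow> dim (fiber X x) = Some 1 \<or> dim (fiber Y x) = Some 1" for x
      using vals[of x] by (auto simp: max_def)
  qed
  then have 1: "dim (?D (X \<union> Y) 1) = max (dim (?D X 1)) (dim (?D Y 1))"
    using Suc.IH def by simp
  have "?D (X \<union> Y) 0 \<union> ?D (X \<union> Y) 1 = (?D X 0 \<union> ?D Y 0) \<union> ?D (X \<union> Y) 1"
    unfolding set_eq_iff Un_iff mem_fiber_dim_set fib
  proof
    show "max (dim (fiber X x)) (dim (fiber Y x)) = Some 0 \<or> max (dim (fiber X x)) (dim (fiber Y x)) = Some 1
        \<longleftrightarrow> (dim (fiber X x) = Some 0 \<or> dim (fiber Y x) = Some 0)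
          \<or> max (dim (fiber X x)) (dim (fiber Y x)) = Some 1" for x
      using vals[of x] by (auto simp: max_def)
  qed
  then have 0: "max (dim (?D (X \<union> Y) 0)) (dim (?D (X \<union> Y) 1))
      = max (max (dim (?D X 0)) (dim (?D Y 0))) (dim (?D (X \<union> Y) 1))"
    using Suc.IH def Def_n_Un by (metis insertI1 insertI2)
  have arith: "max z0 (shift z1 1) = max (max x0 (shift x1 1)) (max y0 (shift y1 1))"
    if "z1 = max x1 y1" "max z0 z1 = max (max x0 y0) z1" for x0 x1 y0 y1 z0 z1
    using that
    by (cases x0; cases x1; cases y0; cases y1; cases z0; cases z1)
      (auto simp: shift_def max_def split: if_splits)
  show ?case
    using arith[OF 1 0] dim_eq[OF Suc.prems(1)] dim_eq[OF Suc.prems(2)] dim_eq[OF XY] by simp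
qed

lemma dim_fiber_dim_set:
  assumes X: "X \<in> Def_n S (Suc n)" and n: "n > 0" and i: "i \<in> {0, 1}"
  shows "dim (X \<inter> butlast -` fiber_dim_set dim X i) = shift (dim (fiber_dim_set dim X i)) i"
proof -
  let ?Y = "X \<inter> butlast -` fiber_dim_set dim X i"
  have "?Y = X \<inter> {xs. length xs = Suc n \<and> butlast xs \<in> fiber_dim_set dim X i}"
    using Def_n_length[OF X] by blast
  then have Y: "?Y \<in> Def_n S (Suc n)"
    using X Def_n_cylinder[OF Def_n_fiber_dim_set[OF assms]] by (simp only: Def_n_Int)
  have "fiber ?Y x = (if dim (fiber X x) = Some i then fiber X x else {})" for x
    by (auto simp: fiber_def mem_fiber_dim_set)
  then have "fiber_dim_set dim ?Y j = (if j = i then fiber_dim_set dim X i else {})" for j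
    by (auto simp: mem_fiber_dim_set dim_empty split: if_splits)
  moreover have "max d None = d" "max None d = d" for d :: "nat option"
    by (cases d; simp add: max_def)+
  ultimately show ?thesis
    using dim_eq[OF Y n] i by (auto simp: dim_empty) (simp add: shift_def)
qed

text \<open>Reduces the exchange of the last two coordinates to the case \<open>n = 2\<close>.\<close>

lemma dim_eq_sections:
  assumes X: "X \<in> Def_n S (Suc (Suc m))" and m: "m > 0"
  defines "D \<equiv> \<lambda>d. {a. length a = m \<and> dim {ys. a @ ys \<in> X} = Some d}"
  shows "dim X = max (dim (D 0)) (max (shift (dim (D 1)) 1) (shift (dim (D 2)) 2))"
proof -
  obtain k where k: "m = Suc k"
    using m gr0_implies_Suc by blast
  let ?F = "fiber_dim_set dim"
  define A where "A i j = ?F (?F X i) j" for i j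
  have F: "?F X i \<in> Def_n S (Suc m)" if "i \<in> {0, 1}" for i
    using Def_n_fiber_dim_set[OF X _ that] by simp
  have A: "A i j \<in> Def_n S m" if "i \<in> {0, 1}" "j \<in> {0, 1}" for i j
    unfolding A_def using Def_n_fiber_dim_set[OF F] that m by simp
  have sect: "dim {ys. a @ ys \<in> X} = max (dim (fiber (?F X 0) a)) (shift (dim (fiber (?F X 1) a)) 1)"
    if a: "length a = m" for a
  proof -
    let ?Z = "{ys. a @ ys \<in> X}"
    have Z: "?Z \<in> Def_n S (Suc 1)"
      using Def_n_section[of X S a 2] X a by (simp add: numeral_2_eq_2)
    have "?F ?Z i = fiber (?F X i) a" if i: "i \<in> {0, 1}" for i
    proof -
      have "?F ?Z i \<in> Def_n S 1"
        using Def_n_fiber_dim_set[OF Z] i by simp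
      moreover have "fiber ?Z [b] = fiber X (a @ [b])" for b
        by (auto simp: fiber_def)
      ultimately show ?thesis
        using Def_n_length
        by (fastforce simp: fiber_def[of "?F X i"] mem_fiber_dim_set length_Suc_conv)
    qed
    then show ?thesis
      using dim_eq[OF Z] by simp
  qed
  have vals: "dim (fiber (?F X 0) a) \<in> {None, Some 0, Some 1}"
      "dim (fiber (?F X 1) a) \<in> {None, Some 0, Some 1}" for a
    using dim_le_1 Def_n_fiber F by (metis insertI1 insertI2)+
  have A_iff: "a \<in> A i j \<longleftrightarrow> length a = m \<and> dim (fiber (?F X i) a) = Some j"
    if "i \<in> {0, 1}" "j \<in> {0, 1}" for i j a
    using Def_n_length[OF A[OF that]] by (auto simp: A_def mem_fiber_dim_set)
  have D_iff: "a \<in> D d \<longleftrightarrow> length a = m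
      \<and> max (dim (fiber (?F X 0) a)) (shift (dim (fiber (?F X 1) a)) 1) = Some d" for a d
    by (auto simp: D_def sect)
  have "a \<in> D 2 \<longleftrightarrow> a \<in> A 1 1"
    and "a \<in> D 1 \<longleftrightarrow> a \<in> (A 0 1 \<union> A 1 0) - A 1 1"
    and "a \<in> D 0 \<longleftrightarrow> a \<in> A 0 0 - (A 0 1 \<union> A 1 0 \<union> A 1 1)" for a
    using vals[of a] by (auto simp: D_iff A_iff shift_def max_def)
  then have D2: "D 2 = A 1 1" and D1: "D 1 = (A 0 1 \<union> A 1 0) - A 1 1"
    and D0: "D 0 = A 0 0 - (A 0 1 \<union> A 1 0 \<union> A 1 1)"
    by blast+
  have D: "D 0 \<in> Def_n S (Suc k)" "D 1 \<in> Def_n S (Suc k)" "D 2 \<in> Def_n S (Suc k)"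
    unfolding D0 D1 D2 k[symmetric] by (intro Def_n_Diff Def_n_Un A; simp)+
  have A': "A i j \<in> Def_n S (Suc k)" if "i \<in> {0, 1}" "j \<in> {0, 1}" for i j
    using A k that by simp
  have "max (dim (D 1)) (dim (D 2)) = dim (D 1 \<union> D 2)"
    by (rule dim_Un[symmetric]; fact D)
  also have "D 1 \<union> D 2 = (A 0 1 \<union> A 1 0) \<union> A 1 1"
    using D1 D2 by blast
  also have "dim \<dots> = max (max (dim (A 0 1)) (dim (A 1 0))) (dim (A 1 1))"
    using dim_Un[of _ k] by (simp add: Def_n_Un A')
  finally have d1: "max (dim (D 1)) (dim (D 2))
      = max (max (dim (A 0 1)) (dim (A 1 0))) (dim (A 1 1))" .
  have D12: "D 1 \<union> D 2 \<in> Def_n S (Suc k)" and A00: "A 0 0 \<in> Def_n S (Suc k)"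
    using D A' by (simp_all add: Def_n_Un)
  have "max (dim (D 0)) (dim (D 1 \<union> D 2)) = dim (D 0 \<union> (D 1 \<union> D 2))"
    using dim_Un[OF D(1) D12] by simp
  also have "D 0 \<union> (D 1 \<union> D 2) = A 0 0 \<union> (D 1 \<union> D 2)"
    using D0 D1 D2 by blast
  also have "dim \<dots> = max (dim (A 0 0)) (dim (D 1 \<union> D 2))"
    using dim_Un[OF A00 D12] .
  finally have d0: "max (dim (D 0)) (max (dim (D 1)) (dim (D 2)))
      = max (dim (A 0 0)) (max (dim (D 1)) (dim (D 2)))"
    using dim_Un[OF D(2,3)] by simp
  have arith: "max (max a00 (shift a01 1)) (shift (max a10 (shift a11 1)) 1)
      = max e0 (max (shift e1 1) (shift e2 2))"
    if "e2 = a11" "max e1 e2 = max (max a01 a10) a11" "max e0 (max e1 e2) = max a00 (max e1 e2)"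
    for a00 a01 a10 a11 e0 e1 e2
    using that
    by (cases a00; cases a01; cases a10; cases a11; cases e0; cases e1)
      (auto simp: shift_def max_def split: if_splits)
  have "dim X = max (max (dim (A 0 0)) (shift (dim (A 0 1)) 1))
      (shift (max (dim (A 1 0)) (shift (dim (A 1 1)) 1)) 1)"
    using dim_eq[OF X] dim_eq[OF F m] by (simp add: A_def)
  then show ?thesis
    using arith[OF arg_cong[OF D2, of dim] d1 d0] by simp
qed

lemma permute_coords_transpose_last:
  assumes "X \<in> Def_n S (Suc (Suc m))" "length a = m"
  shows "{ys. a @ ys \<in> permute_coords (Suc (Suc m)) (transpose m (Suc m)) X}
    = switch {ys. a @ ys \<in> X}"
proof -
  let ?\<tau> = "transpose m (Suc m)"
  have \<tau>: "?\<tau> permutes {..<Suc (Suc m)}"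
    by (intro permutes_swap_id) auto
  have "map (\<lambda>i. (a @ [x, y]) ! ?\<tau> i) [0..<Suc (Suc m)] = a @ [y, x]" for x y
    using assms(2) by (auto intro!: nth_equalityI simp: transpose_def nth_append less_Suc_eq)
  then have "a @ [x, y] \<in> permute_coords (Suc (Suc m)) ?\<tau> X \<longleftrightarrow> a @ [y, x] \<in> X" for x y
    using assms(2) by (simp add: mem_permute_coords[OF assms(1) \<tau>] del: upt_Suc)
  moreover have "\<exists>x y. ys = [x, y]" if "a @ ys \<in> permute_coords (Suc (Suc m)) ?\<tau> X" for ys
    using Def_n_length[OF Def_n_permute[OF assms(1) \<tau>] that] assms(2)
    by (auto simp: numeral_2_eq_2 length_Suc_conv)
  ultimately show ?thesis
    unfolding switch_def by blast
qed

lemma dim_permute_last: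
  assumes X: "X \<in> Def_n S (Suc (Suc m))"
  shows "dim (permute_coords (Suc (Suc m)) (transpose m (Suc m)) X) = dim X"
proof (cases "m = 0")
  case True
  then show ?thesis
    using permute_coords_transpose_last[OF X, of "[]"] dim_switch X by (simp add: numeral_2_eq_2)
next
  case False
  let ?Y = "permute_coords (Suc (Suc m)) (transpose m (Suc m)) X"
  have Y: "?Y \<in> Def_n S (Suc (Suc m))"
    using X by (intro Def_n_permute permutes_swap_id) auto
  have "dim {ys. a @ ys \<in> ?Y} = dim {ys. a @ ys \<in> X}" if "length a = m" for a
    using permute_coords_transpose_last[OF X that] dim_switch Def_n_section[of X S a 2] X that
    by simp
  then have "{a. length a = m \<and> dim {ys. a @ ys \<in> ?Y} = Some d}
      = {a. length a = m \<and> dim {ys. a @ ys \<in> X} = Some d}" for d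
    by auto
  then show ?thesis
    using dim_eq_sections[OF X] dim_eq_sections[OF Y] False by simp
qed

lemma dim_permute_init:
  assumes X: "X \<in> Def_n S (Suc n)" and n: "n > 0" and \<sigma>: "\<sigma> permutes {..<n}"
    and IH: "\<And>Z. Z \<in> Def_n S n \<Longrightarrow> dim (permute_coords n \<sigma> Z) = dim Z"
  shows "dim (permute_coords (Suc n) \<sigma> X) = dim X"
proof -
  let ?F = "fiber_dim_set dim" and ?Y = "permute_coords (Suc n) \<sigma> X"
  have \<sigma>': "\<sigma> permutes {..<Suc n}"
    using \<sigma> by (rule permutes_subset) auto
  have Y: "?Y \<in> Def_n S (Suc n)"
    using Def_n_permute[OF X \<sigma>'] .
  have inv: "inv \<sigma> i < n" if "i < n" for i
    using permutes_in_image[OF permutes_inv[OF \<sigma>]] that by auto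
  have "inv \<sigma> n = n"
    using permutes_not_in[OF permutes_inv[OF \<sigma>]] by simp
  then have "map (\<lambda>i. (x @ [y]) ! inv \<sigma> i) [0..<Suc n] = map (\<lambda>i. x ! inv \<sigma> i) [0..<n] @ [y]"
    if "length x = n" for x :: "'a list" and y
    using inv that by (simp add: nth_append)
  then have fib: "fiber ?Y x = fiber X (map (\<lambda>i. x ! inv \<sigma> i) [0..<n])" if "length x = n" for x
    using that by (simp add: fiber_def mem_permute_coords[OF X \<sigma>'] del: upt_Suc)
  have "x \<in> ?F ?Y i \<longleftrightarrow> x \<in> permute_coords n \<sigma> (?F X i)" if "i \<in> {0, 1}" for x i
  proof -
    have "x \<in> ?F ?Y i \<longleftrightarrow> length x = n \<and> x \<in> ?F ?Y i"
      using Def_n_length[OF Def_n_fiber_dim_set[OF Y n that]] by blast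
    also have "\<dots> \<longleftrightarrow> length x = n \<and> map (\<lambda>i. x ! inv \<sigma> i) [0..<n] \<in> ?F X i"
      using fib[of x] by (auto simp only: mem_fiber_dim_set)
    also have "\<dots> \<longleftrightarrow> x \<in> permute_coords n \<sigma> (?F X i)"
      using mem_permute_coords[OF Def_n_fiber_dim_set[OF X n that] \<sigma>] by simp
    finally show ?thesis .
  qed
  then have "?F ?Y i = permute_coords n \<sigma> (?F X i)" if "i \<in> {0, 1}" for i
    using that by blast
  then show ?thesis
    using IH Def_n_fiber_dim_set[OF X n] by (simp add: dim_eq[OF X n] dim_eq[OF Y n])
qed

text \<open>Every permutation of \<open>{..<Suc n}\<close> is a product of permutations fixing \<open>n\<close> and of the transposition
  of \<open>n - 1\<close> and \<open>n\<close>.\<close>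

lemma dim_permute:
  assumes "X \<in> Def_n S n" "n > 0" "\<sigma> permutes {..<n}"
  shows "dim (permute_coords n \<sigma> X) = dim X"
  using assms
proof (induction n arbitrary: X \<sigma>)
  case (Suc n)
  show ?case
  proof (cases "n = 0")
    case True
    then have "\<sigma> = id"
      using Suc.prems(3) by (simp add: lessThan_Suc)
    then have "permute_coords (Suc n) \<sigma> X = X"
      using Def_n_length[OF Suc.prems(1)] True
      by (force simp: permute_coords_def length_Suc_conv image_iff)
    then show ?thesis by simp
  next
    case False
    then obtain m where m: "n = Suc m"
      using not0_implies_Suc by blast
    have init: "dim (permute_coords (Suc n) \<rho> Z) = dim Z"
      if "Z \<in> Def_n S (Suc n)" "\<rho> permutes {..<n}" for Z \<rho>
      using dim_permute_init[OF that(1) _ that(2)] Suc.IH that(2) False by simp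
    show ?thesis
    proof (cases "\<sigma> n = n")
      case True
      have "\<sigma> permutes {..<n}"
        by (rule permutes_superset[OF Suc.prems(3)]) (use True in \<open>auto simp: less_Suc_eq\<close>)
      then show ?thesis
        using init Suc.prems(1) by simp
    next
      case neq: False
      have "\<sigma> n < n"
        using permutes_in_image[OF Suc.prems(3), of n] neq by simp
      define s where "s = transpose (\<sigma> n) m"
      define t where "t = transpose m n"
      define \<rho> where "\<rho> = transpose (\<sigma> n) n \<circ> \<sigma>"
      have s: "s permutes {..<n}"
        unfolding s_def using \<open>\<sigma> n < n\<close> m by (intro permutes_swap_id) auto
      then have s': "s permutes {..<Suc n}"
        by (rule permutes_subset) auto
      have t: "t permutes {..<Suc n}"
        unfolding t_def using m by (intro permutes_swap_id) auto
      have "transpose (\<sigma> n) n permutes {..<Suc n}"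
        using \<open>\<sigma> n < n\<close> by (intro permutes_swap_id) auto
      then have \<rho>': "\<rho> permutes {..<Suc n}"
        unfolding \<rho>_def using Suc.prems(3) by (rule permutes_compose[rotated])
      have \<rho>: "\<rho> permutes {..<n}"
        by (rule permutes_superset[OF \<rho>']) (auto simp: less_Suc_eq \<rho>_def)
      have "s \<circ> t \<circ> s = transpose (\<sigma> n) n"
        unfolding s_def t_def using \<open>\<sigma> n < n\<close> m by (auto simp: fun_eq_iff transpose_def)
      then have "\<sigma> = s \<circ> t \<circ> s \<circ> \<rho>"
        by (simp add: \<rho>_def fun_eq_iff)
      then have "permute_coords (Suc n) \<sigma> X = permute_coords (Suc n) \<rho>
          (permute_coords (Suc n) s (permute_coords (Suc n) t (permute_coords (Suc n) s X)))"
        by (simp add: permute_coords_comp \<rho>' s' t comp_assoc)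
      moreover have "dim (permute_coords (Suc n) t Z) = dim Z" if "Z \<in> Def_n S (Suc n)" for Z
        using dim_permute_last that unfolding t_def m by blast
      ultimately show ?thesis
        using Suc.prems(1) by (simp add: init \<rho> s Def_n_permute s' t)
    qed
  qed
qed simp

end

theorem proposition2p5:
  fixes S :: "('f, 'r, 'a) fo_structure"
    and dim :: "'a list set \<Rightarrow> nat option"
  assumes "weak_dimension_function S dim"
  shows "dimension_function S dim"
proof -
  have pred: "\<exists>m>0. n = Suc m" if "n > 1" for n :: nat
    using that by (intro exI[of _ "n - 1"]) auto
  show ?thesis
    unfolding dimension_function_def
  proof (intro conjI allI impI ballI)
    show "dim {} = None" "\<And>a. dim {[a]} = Some 0" "dim {xs. length xs = 1} = Some 1"
      using assms unfolding weak_dimension_function_def by blast+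
    show "dim (X \<union> Y) = max (dim X) (dim Y)"
      if "n > 0" "X \<in> Def_n S n" "Y \<in> Def_n S n" for n X Y
      using dim_Un[OF assms] that gr0_implies_Suc by metis
    show "dim X = dim (permute_coords n \<sigma> X)"
      if "n > 0" "X \<in> Def_n S n" "\<sigma> permutes {..<n}" for n X \<sigma>
      using dim_permute[OF assms] that by simp
    fix n X and i :: nat
    assume *: "n > 1" "X \<in> Def_n S n" "i \<in> {0, 1}"
    then obtain m where m: "n = Suc m" "m > 0"
      using pred by blast
    show "fiber_dim_set dim X i \<in> Def_n S (n - 1)"
      using Def_n_fiber_dim_set[OF assms] * m by simp
    show "dim (X \<inter> butlast -` fiber_dim_set dim X i) = shift (dim (fiber_dim_set dim X i)) i"
      using dim_fiber_dim_set[OF assms] * m by simp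
  qed
qed

end
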